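(* Let $m,n,p$ be positive integers with $p\ge 2$, and let $\mathcal{S}\in F(m,n,p)$ be an f-diagonal tensor. Then $\mathcal{S}$ is an s-diagonal tensor, i.e. $\mathcal{S}\in S(m,n,p)$, if and only if $G(\mathcal{S})=\mathcal{S}$, where $G$ is the Kilmer-Martin mapping.
   Context: Let $T(m,n,p)$ be the real linear space of $m\times n\times p$ real tensors; $\mathcal{A}(i,j,k)$ denotes the entries of $\mathcal{A}\in T(m,n,p)$ and $A^{(k)}=\mathcal{A}(:,:,k)\in\mathbb{R}^{m\times n}$ its frontal slices, $k=1,\dots,p$. A tensor is f-diagonal if all its frontal slices are (rectangular) diagonal matrices; $F(m,n,p)$ is the set of f-diagonal tensors in $T(m,n,p)$. Kilmer-Martin mapping $G:T(m,n,p)\to F(m,n,p)$. Let $\omega=e^{2\pi\sqrt{-1}/p}$. For $\mathcal{A}\in T(m,n,p)$ and $k=1,\dots,p$ put $\Delta^{(k)}(\mathcal{A})=\sum_{l=1}^p\omega^{(l-1)(k-1)}A^{(l)}\in\mathbb{C}^{m\times n}$, and let $D^{(k)}\in\mathbb{R}^{m\times n}$ be the diagonal matrix whose diagonal entries $\mathcal{D}(i,i,k)$, $i=1,\dots,\min\{m,n\}$, are the singular values of $\Delta^{(k)}(\mathcal{A})$ in nonincreasing order (counted with multiplicity). Then $\mathcal{S}=G(\mathcal{A})$ is the f-diagonal tensor with $\mathcal{S}(i,i,k)=\frac1p\sum_{l=1}^p\bar\omega^{(k-1)(l-1)}\mathcal{D}(i,i,l)$ for $i=1,\dots,\min\{m,n\}$,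 $k=1,\dots,p$ (these numbers are real). A tensor $\mathcal{S}\in F(m,n,p)$ is called s-diagonal if there is some $\mathcal{A}\in T(m,n,p)$ with $G(\mathcal{A})=\mathcal{S}$; $S(m,n,p)$ denotes the set of all s-diagonal tensors in $F(m,n,p)$. *)

theory Defs
  imports
    "Jordan_Normal_Form.Schur_Decomposition"
    "HOL-Computational_Algebra.Fundamental_Theorem_Algebra"
begin

text \<open>
  An m x n x p tensor is the list of its p frontal slices, each a real m x n matrix. All indices
  start from 0, so an exponent (l - 1)(k - 1) in the usual 1-based notation becomes l * k.
\<close>

definition tensors :: "nat \<Rightarrow> nat \<Rightarrow> nat \<Rightarrow> real mat list set" where
  "tensors m n p = {A. length A = p \<and> set A \<subseteq> carrier_mat m n}"

definition f_diagonal :: "nat \<Rightarrow> nat \<Rightarrow> nat \<Rightarrow> real mat list set" where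
  "f_diagonal m n p = {A \<in> tensors m n p. \<forall>M \<in> set A. diagonal_mat M}"

text \<open>
  The min m n singular values of an m x n complex matrix M, with multiplicity and in nonincreasing
  order: the square roots of the largest min m n eigenvalues (with algebraic multiplicity) of the
  n x n positive semidefinite matrix M* M. These eigenvalues are real and nonnegative, so Re only
  changes the type. If n > m, the truncation drops n - m of the zero eigenvalues.
\<close>

definition singular_values :: "complex mat \<Rightarrow> real list" where
  "singular_values M = take (min (dim_row M) (dim_col M))
     (rev (sorted_list_of_multiset
       (image_mset (\<lambda>x. sqrt (Re x)) (proots (char_poly (mat_adjoint M * M))))))"

lemma length_singular_values:
  "length (singular_values M) = min (dim_row M) (dim_col M)"
proof -
  let ?B = "mat_adjoint M * M"
  have "?B \<in> carrier_mat (dim_col M) (dim_col M)"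
    by (auto simp: mat_adjoint_def)
  then have "size (proots (char_poly ?B)) = dim_col M"
    using degree_monic_char_poly size_proots_complex by metis
  moreover have "length (sorted_list_of_multiset X) = size X" for X :: "real multiset"
    by (metis mset_sorted_list_of_multiset size_mset)
  ultimately show ?thesis
    by (simp add: singular_values_def)
qed

definition dft_root :: "nat \<Rightarrow> complex" where
  "dft_root p = exp (2 * of_real pi * \<i> / of_nat p)"

definition Delta_slice :: "nat \<Rightarrow> nat \<Rightarrow> nat \<Rightarrow> real mat list \<Rightarrow> nat \<Rightarrow> complex mat" where
  "Delta_slice m n p A k =
     mat m n (\<lambda>(i, j). \<Sum>l<p. dft_root p ^ (l * k) * of_real (A ! l $$ (i, j)))"

definition D_slice :: "nat \<Rightarrow> nat \<Rightarrow> nat \<Rightarrow> real mat list \<Rightarrow> nat \<Rightarrow> real mat" where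
  "D_slice m n p A k =
     mat m n (\<lambda>(i, j). if i = j then singular_values (Delta_slice m n p A k) ! i else 0)"

text \<open>
  The Kilmer-Martin mapping. The inverse DFT below is real: the slices of a real tensor satisfy
  Delta(p - k) = cnj (Delta k) for 0 < k < p, conjugate matrices have the same singular values,
  and Delta 0 is real. So Re only changes the type here.
\<close>

definition kilmer_martin :: "nat \<Rightarrow> nat \<Rightarrow> nat \<Rightarrow> real mat list \<Rightarrow> real mat list" where
  "kilmer_martin m n p A = map (\<lambda>k. mat m n (\<lambda>(i, j).
     if i = j
     then Re (1 / of_nat p * (\<Sum>l<p. cnj (dft_root p) ^ (k * l) * of_real (D_slice m n p A l $$ (i, i))))
     else 0)) [0..<p]"

lemma kilmer_martin_f_diagonal: "kilmer_martin m n p A \<in> f_diagonal m n p"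
  by (auto simp: kilmer_martin_def f_diagonal_def tensors_def diagonal_mat_def)

definition s_diagonal :: "nat \<Rightarrow> nat \<Rightarrow> nat \<Rightarrow> real mat list set" where
  "s_diagonal m n p =
     {S \<in> f_diagonal m n p. \<exists>A \<in> tensors m n p. kilmer_martin m n p A = S}"

end

theory Submission
  imports Defs
begin

text \<open>
  The mapping is idempotent. Since the slices \<open>\<Delta>\<close> of a real tensor are conjugate-symmetric in the
  frequency, so are their singular values, and taking the real part in the inverse DFT loses
  nothing. The DFT of \<open>G(A)\<close> therefore returns the diagonal matrices of singular values of the
  \<open>\<Delta>\<close> slices of \<open>A\<close>. These are nonnegative and nonincreasing along the diagonal, hence they are
  their own singular values, and a second application of \<open>G\<close> changes nothing.
\<close>

lemma dim_mat_adjoint [simp]: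
  "dim_row (mat_adjoint M) = dim_col M" "dim_col (mat_adjoint M) = dim_row M"
  by (simp_all add: mat_adjoint_def)

lemma mat_adjoint_index [simp]:
  fixes M :: "complex mat"
  assumes "i < dim_col M" and "j < dim_row M"
  shows "mat_adjoint M $$ (i, j) = cnj (M $$ (j, i))"
  using assms by (simp add: mat_adjoint_def mat_of_rows_index conjugate_complex_def)

lemma mat_mult_index_sum:
  assumes "i < dim_row A" and "j < dim_col B" and "dim_col A = dim_row B"
  shows "(A * B) $$ (i, j) = (\<Sum>r<dim_row B. A $$ (i, r) * B $$ (r, j))"
  using assms by (simp add: scalar_prod_def atLeast0LessThan)

lemma mat_adjoint_mult_self_index:
  fixes M :: "complex mat"
  assumes "i < dim_col M" and "j < dim_col M"
  shows "(mat_adjoint M * M) $$ (i, j) = (\<Sum>r<dim_row M. cnj (M $$ (r, i)) * M $$ (r, j))"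
  using assms by (subst mat_mult_index_sum) auto

lemma eigenvalue_mat_adjoint_mult_self_nonneg:
  fixes M :: "complex mat"
  assumes "eigenvalue (mat_adjoint M * M) a"
  shows "0 \<le> Re a"
proof -
  let ?m = "dim_row M" and ?n = "dim_col M"
  obtain v where v: "v \<in> carrier_vec ?n" "v \<noteq> 0\<^sub>v ?n"
    and ev: "(mat_adjoint M * M) *\<^sub>v v = a \<cdot>\<^sub>v v"
    using assms by (auto simp: eigenvalue_def eigenvector_def)
  define w where "w r = (\<Sum>j<?n. M $$ (r, j) * v $ j)" for r
  have ev_i: "a * v $ i = (\<Sum>r<?m. cnj (M $$ (r, i)) * w r)" if i: "i < ?n" for i
  proof -
    have "a * v $ i = ((mat_adjoint M * M) *\<^sub>v v) $ i"
      using i v by (simp add: ev)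
    also have "\<dots> = (\<Sum>j<?n. (mat_adjoint M * M) $$ (i, j) * v $ j)"
      using i v by (simp add: scalar_prod_def atLeast0LessThan)
    also have "\<dots> = (\<Sum>j<?n. \<Sum>r<?m. cnj (M $$ (r, i)) * (M $$ (r, j) * v $ j))"
      using i by (simp add: mat_adjoint_mult_self_index sum_distrib_right mult.assoc
          del: index_mult_mat)
    also have "\<dots> = (\<Sum>r<?m. cnj (M $$ (r, i)) * w r)"
      by (subst sum.swap) (simp add: w_def sum_distrib_left)
    finally show ?thesis .
  qed
  have "a * of_real (\<Sum>i<?n. (cmod (v $ i))\<^sup>2) = (\<Sum>i<?n. a * v $ i * cnj (v $ i))"
    by (simp only: of_real_sum complex_norm_square sum_distrib_left mult.assoc)
  also have "\<dots> = (\<Sum>i<?n. \<Sum>r<?m. w r * cnj (M $$ (r, i) * v $ i))"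
    by (simp add: ev_i sum_distrib_left sum_distrib_right mult_ac)
  also have "\<dots> = (\<Sum>r<?m. w r * cnj (w r))"
    by (subst sum.swap) (simp add: w_def sum_distrib_left)
  also have "\<dots> = of_real (\<Sum>r<?m. (cmod (w r))\<^sup>2)"
    by (simp only: of_real_sum complex_norm_square)
  finally have eq: "Re a * (\<Sum>i<?n. (cmod (v $ i))\<^sup>2) = (\<Sum>r<?m. (cmod (w r))\<^sup>2)"
    by (metis Re_complex_of_real times_complex.sel(1) Im_complex_of_real mult_zero_right diff_zero)
  obtain i where "i < ?n" "v $ i \<noteq> 0"
    using v by (metis carrier_vecD dim_vec eq_vecI index_zero_vec)
  then have "0 < (\<Sum>i<?n. (cmod (v $ i))\<^sup>2)"
    by (intro sum_pos2[of _ i]) auto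
  moreover have "0 \<le> Re a * (\<Sum>i<?n. (cmod (v $ i))\<^sup>2)"
    unfolding eq by (intro sum_nonneg) auto
  ultimately show ?thesis
    by (simp add: zero_le_mult_iff)
qed

lemma singular_values_nonneg:
  assumes "x \<in> set (singular_values M)"
  shows "0 \<le> x"
proof -
  let ?B = "mat_adjoint M * M"
  have B: "?B \<in> carrier_mat (dim_col M) (dim_col M)"
    by auto
  have "char_poly ?B \<noteq> 0"
    using degree_monic_char_poly[OF B] by auto
  moreover have "x \<in># image_mset (\<lambda>x. sqrt (Re x)) (proots (char_poly ?B))"
    using in_set_takeD[OF assms[unfolded singular_values_def]] by simp
  ultimately obtain a where "x = sqrt (Re a)" "poly (char_poly ?B) a = 0"
    by auto
  then show ?thesis
    using eigenvalue_mat_adjoint_mult_self_nonneg[of M a] eigenvalue_root_char_poly[OF B, of a] by simp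
qed

lemma sorted_singular_values: "sorted_wrt (\<ge>) (singular_values M)"
  unfolding singular_values_def by (intro sorted_wrt_take) (simp add: sorted_wrt_rev)

lemma singular_values_cnj: "singular_values (map_mat cnj M) = singular_values M"
proof -
  have "mat_adjoint (map_mat cnj M) * map_mat cnj M = transpose_mat (mat_adjoint M * M)"
    by (rule eq_matI)
      (auto simp: mat_adjoint_mult_self_index mult.commute simp del: index_mult_mat(1))
  moreover have "mat_adjoint M * M \<in> carrier_mat (dim_col M) (dim_col M)"
    by auto
  ultimately show ?thesis
    by (simp add: singular_values_def)
qed

lemma singular_values_diagonal:
  assumes len: "length xs = min m n" and sorted: "sorted_wrt (\<ge>) xs"
    and nonneg: "\<And>x. x \<in> set xs \<Longrightarrow> 0 \<le> x"
  shows "singular_values (mat m n (\<lambda>(i, j). if i = j then complex_of_real (xs ! i) else 0)) = xs"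
proof -
  let ?M = "mat m n (\<lambda>(i, j). if i = j then complex_of_real (xs ! i) else 0)"
  let ?B = "mat_adjoint ?M * ?M"
  define ys where "ys = xs @ replicate (n - m) 0"
  have len_ys: "length ys = n"
    using len by (simp add: ys_def)
  have B: "?B \<in> carrier_mat n n"
    by auto
  have entry: "?B $$ (i, j) = (if i = j then of_real ((ys ! i)\<^sup>2) else 0)"
    if "i < n" "j < n" for i j
  proof -
    have "?B $$ (i, j) = (\<Sum>r<m. cnj (?M $$ (r, i)) * ?M $$ (r, j))"
      using that by (subst mat_adjoint_mult_self_index) auto
    also have "\<dots> = (\<Sum>r<m. if r = i then if i = j then of_real ((xs ! i)\<^sup>2) else 0 else 0)"
      using that by (intro sum.cong) (auto simp: power2_eq_square)
    also have "\<dots> = (if i = j then of_real ((ys ! i)\<^sup>2) else 0)"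
      using that len by (auto simp: ys_def nth_append)
    finally show ?thesis .
  qed
  have "upper_triangular ?B"
    using B entry by (intro upper_triangularI) auto
  then have "char_poly ?B = (\<Prod>a \<leftarrow> diag_mat ?B. [:- a, 1:])"
    by (rule char_poly_upper_triangular[OF B])
  also have "diag_mat ?B = map (\<lambda>y. of_real (y\<^sup>2)) ys"
    using B entry len_ys by (intro nth_equalityI) (auto simp: diag_mat_def simp del: index_mult_mat(1))
  finally have "proots (char_poly ?B) = mset (map (\<lambda>y. of_real (y\<^sup>2)) ys)"
    using proots_prod_list[of "map (\<lambda>y. [:- of_real (y\<^sup>2), 1 :: complex:]) ys"]
    by (auto simp: o_def image_iff)
  then have "image_mset (\<lambda>x. sqrt (Re x)) (proots (char_poly ?B)) = mset (map (\<lambda>y. \<bar>y\<bar>) ys)"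
    by (simp add: multiset.map_comp o_def)
  also have "map (\<lambda>y. \<bar>y\<bar>) ys = ys"
    using nonneg by (intro map_idI) (auto simp: ys_def)
  also have "sorted (rev ys)"
    using sorted nonneg by (auto simp: ys_def sorted_append sorted_wrt_rev)
  then have "rev (sorted_list_of_multiset (mset ys)) = ys"
    by (simp add: sorted_list_of_multiset_mset properties_for_sort[of "rev ys" ys])
  ultimately show ?thesis
    using len by (simp add: singular_values_def ys_def)
qed

lemma dft_root_power: "dft_root p ^ k = cis (2 * pi * real k / real p)"
  by (simp add: dft_root_def cis_conv_exp flip: exp_of_nat_mult) (simp add: mult_ac)

lemma dft_root_power_self:
  assumes "p > 0"
  shows "dft_root p ^ p = 1"
  using assms by (simp add: dft_root_power)

lemma dft_root_mult_cnj: "dft_root p * cnj (dft_root p) = 1"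
  using dft_root_power[of p 1] by (simp add: cis_cnj cis_mult)

lemma inj_on_dft_root_power: "inj_on (\<lambda>k. dft_root p ^ k) {..<p}"
  using bij_betw_imp_inj_on[OF bij_betw_roots_unity[of p]]
  by (cases "p = 0") (auto simp: dft_root_power)

lemma dft_root_orthogonality:
  assumes "j < p" and "k < p"
  shows "(\<Sum>l<p. dft_root p ^ (l * k) * cnj (dft_root p) ^ (l * j)) = (if j = k then of_nat p else 0)"
proof -
  define z where "z = dft_root p ^ k * cnj (dft_root p) ^ j"
  have "(\<Sum>l<p. dft_root p ^ (l * k) * cnj (dft_root p) ^ (l * j)) = (\<Sum>l<p. z ^ l)"
    by (simp add: z_def power_mult_distrib mult.commute flip: power_mult)
  moreover have "z ^ p = 1"
    using assms dft_root_power_self[of p]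
    by (simp add: z_def power_mult_distrib power_mult mult.commute[of _ p]
        flip: power_mult complex_cnj_power) (simp add: power_mult)
  moreover have "z * dft_root p ^ j = dft_root p ^ k"
    by (simp add: z_def mult.assoc mult.commute[of "cnj _"] dft_root_mult_cnj flip: power_mult_distrib)
  then have "z = 1 \<Longrightarrow> j = k"
    using inj_onD[OF inj_on_dft_root_power[of p], of j k] assms by simp
  moreover have "z = 1" if "j = k"
    using that by (simp add: z_def dft_root_mult_cnj flip: power_mult_distrib)
  ultimately show ?thesis
    by (cases "z = 1") (auto simp: geometric_sum)
qed

lemma cnj_dft_root_power_reverse:
  assumes "l < p"
  shows "dft_root p ^ (k * ((p - l) mod p)) = cnj (dft_root p) ^ (k * l)"
proof -
  have "dft_root p ^ ((p - l) mod p) * dft_root p ^ l = 1"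
    using assms dft_root_power_self[of p] by (cases "l = 0") (auto simp flip: power_add)
  moreover have "cnj (dft_root p) ^ l * dft_root p ^ l = 1"
    by (simp add: mult.commute dft_root_mult_cnj flip: power_mult_distrib)
  ultimately have "dft_root p ^ ((p - l) mod p) = cnj (dft_root p) ^ l"
    by (metis mult.commute mult.left_commute mult_1)
  then show ?thesis
    by (metis mult.commute power_mult)
qed

lemma sum_reverse_mod:
  fixes f :: "nat \<Rightarrow> 'a::comm_monoid_add"
  shows "(\<Sum>l<p. f ((p - l) mod p)) = (\<Sum>l<p. f l)"
proof -
  have "(p - (p - l) mod p) mod p = l" "(p - l) mod p \<in> {..<p}" if "l \<in> {..<p}" for l
    using that by (cases "l = 0"; simp)+
  then show ?thesis
    by (intro sum.reindex_bij_witness[where i = "\<lambda>l. (p - l) mod p"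
          and j = "\<lambda>l. (p - l) mod p"]) simp_all
qed

lemma Delta_slice_reverse:
  assumes "k < p"
  shows "Delta_slice m n p A ((p - k) mod p) = map_mat cnj (Delta_slice m n p A k)"
  using assms by (intro eq_matI) (auto simp: Delta_slice_def cnj_dft_root_power_reverse)

lemma D_slice_reverse:
  assumes "k < p"
  shows "D_slice m n p A ((p - k) mod p) = D_slice m n p A k"
  by (simp only: D_slice_def Delta_slice_reverse[OF assms] singular_values_cnj)

lemma inverse_dft_real:
  fixes d :: "nat \<Rightarrow> real"
  assumes "\<And>l. l < p \<Longrightarrow> d ((p - l) mod p) = d l"
  shows "of_real (Re (1 / of_nat p * (\<Sum>l<p. cnj (dft_root p) ^ (k * l) * of_real (d l)))) =
    1 / of_nat p * (\<Sum>l<p. cnj (dft_root p) ^ (k * l) * of_real (d l))"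
proof -
  let ?f = "\<lambda>l. dft_root p ^ (k * l) * complex_of_real (d l)"
  have "(\<Sum>l<p. cnj (dft_root p) ^ (k * l) * of_real (d l)) = (\<Sum>l<p. ?f ((p - l) mod p))"
    using assms by (simp add: cnj_dft_root_power_reverse)
  also have "\<dots> = (\<Sum>l<p. ?f l)"
    by (rule sum_reverse_mod)
  finally have "cnj (1 / of_nat p * (\<Sum>l<p. cnj (dft_root p) ^ (k * l) * of_real (d l))) =
      1 / of_nat p * (\<Sum>l<p. cnj (dft_root p) ^ (k * l) * of_real (d l))"
    by simp
  then show ?thesis
    by (intro of_real_Re) (simp add: Reals_cnj_iff)
qed

lemma dft_inverse_dft:
  fixes d :: "nat \<Rightarrow> complex"
  assumes "k < p"
  shows "(\<Sum>l<p. dft_root p ^ (l * k) *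
    (1 / of_nat p * (\<Sum>j<p. cnj (dft_root p) ^ (l * j) * d j))) = d k"
proof -
  have "(\<Sum>l<p. dft_root p ^ (l * k) * (1 / of_nat p * (\<Sum>j<p. cnj (dft_root p) ^ (l * j) * d j))) =
      (\<Sum>l<p. \<Sum>j<p. d j / of_nat p * (dft_root p ^ (l * k) * cnj (dft_root p) ^ (l * j)))"
    by (simp add: sum_distrib_left sum_divide_distrib mult_ac)
  also have "\<dots> = (\<Sum>j<p. d j / of_nat p * (if j = k then of_nat p else 0))"
    by (subst sum.swap, rule sum.cong)
      (simp_all only: sum_distrib_left[symmetric] dft_root_orthogonality[OF _ assms] lessThan_iff)
  also have "\<dots> = d k"
    using assms by (simp add: if_distrib[where f = "\<lambda>x. _ * x"] cong: if_cong)
  finally show ?thesis .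
qed

lemma Delta_slice_kilmer_martin:
  assumes "k < p"
  shows "Delta_slice m n p (kilmer_martin m n p A) k =
    mat m n (\<lambda>(i, j). if i = j then of_real (singular_values (Delta_slice m n p A k) ! i) else 0)"
proof (rule eq_matI; simp only: dim_row_mat dim_col_mat Delta_slice_def)
  fix i j assume ij: "i < m" "j < n"
  let ?d = "\<lambda>l. D_slice m n p A l $$ (i, i)"
  show "mat m n (\<lambda>(i, j). \<Sum>l<p. dft_root p ^ (l * k) *
      of_real (kilmer_martin m n p A ! l $$ (i, j))) $$ (i, j) =
    mat m n (\<lambda>(i, j). if i = j then of_real (singular_values
      (mat m n (\<lambda>(i, j). \<Sum>l<p. dft_root p ^ (l * k) *
        of_real (A ! l $$ (i, j)))) ! i) else 0) $$ (i, j)"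
  proof (cases "i = j")
    case True
    have "(\<Sum>l<p. dft_root p ^ (l * k) * of_real (kilmer_martin m n p A ! l $$ (i, i))) =
        (\<Sum>l<p. dft_root p ^ (l * k) *
          (1 / of_nat p * (\<Sum>j<p. cnj (dft_root p) ^ (l * j) * of_real (?d j))))"
      using ij True
      by (intro sum.cong refl, subst inverse_dft_real[symmetric])
        (auto simp: kilmer_martin_def D_slice_reverse)
    also have "\<dots> = of_real (?d k)"
      using assms by (rule dft_inverse_dft)
    finally show ?thesis
      using ij True by (simp add: D_slice_def Delta_slice_def)
  next
    case False
    then show ?thesis
      using ij by (simp add: kilmer_martin_def)
  qed
qed

lemma D_slice_kilmer_martin:
  assumes "k < p"
  shows "D_slice m n p (kilmer_martin m n p A) k = D_slice m n p A k"
proof -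
  have "length (singular_values (Delta_slice m n p A k)) = min m n"
    by (simp add: length_singular_values Delta_slice_def)
  then show ?thesis
    unfolding D_slice_def Delta_slice_kilmer_martin[OF assms]
    by (subst singular_values_diagonal) (auto intro: sorted_singular_values singular_values_nonneg)
qed

lemma kilmer_martin_idempotent:
  "kilmer_martin m n p (kilmer_martin m n p A) = kilmer_martin m n p A"
  by (subst (1 3) kilmer_martin_def) (simp add: D_slice_kilmer_martin cong: sum.cong_simp if_cong)

theorem theorem4p3:
  fixes m n p :: nat and S :: "real mat list"
  assumes "m \<ge> 1" and "n \<ge> 1" and "p \<ge> 2"
    and "S \<in> f_diagonal m n p"
  shows "S \<in> s_diagonal m n p \<longleftrightarrow> kilmer_martin m n p S = S"
proof
  assume "S \<in> s_diagonal m n p"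
  then show "kilmer_martin m n p S = S"
    by (auto simp: s_diagonal_def kilmer_martin_idempotent)
next
  assume "kilmer_martin m n p S = S"
  then show "S \<in> s_diagonal m n p"
    using assms(4) by (auto simp: s_diagonal_def f_diagonal_def)
qed

end
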